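(* Let $G\in\mathscr{B}$ be a graph on $n$ vertices with $\operatorname{diam}(G)=2m+1$, where $m\ge 2$. Then (i) $\operatorname{In}(E(G))=(2,2,n-4)$; and (ii) the spectrum of $E(G)$ is symmetric with respect to the origin, i.e. for every real $\mu$, $\mu$ and $-\mu$ are eigenvalues of $E(G)$ with the same multiplicity.
   Context: All graphs are finite, simple and connected; $d(u,v)$ is the distance in $G$, $e(u)=\max_v d(u,v)$ the eccentricity, $\operatorname{diam}(G)=\max_u e(u)$. The eccentricity matrix $E(G)$ of $G$ with vertices $v_1,\dots,v_n$ is the $n\times n$ matrix with $(i,j)$ entry $d(v_i,v_j)$ if $d(v_i,v_j)=\min\{e(v_i),e(v_j)\}$ and $0$ otherwise. For a real symmetric matrix $A$, $\operatorname{In}(A)=(i_+(A),i_-(A),i_0(A))$ counts positive, negative and zero eigenvalues with multiplicity. A block is a maximal connected subgraph without a cut-vertex. A bi-block graph is a connected graph all of whose blocks are complete bipartite graphs. $\mathscr{B}$ is the class of bi-block graphs with at least two blocks in which every block contains at most two cut-vertices of $G$. *)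

theory Defs
  imports "Jordan_Normal_Form.Char_Poly" "Graph_Theory.Graph_Theory"
begin

text \<open>
  Following \<^theory>\<open>Graph_Theory.Digraph\<close>, a finite simple graph is a \<open>G\<close> with \<^prop>\<open>graph G\<close>,
  that is, a finite symmetric digraph without loops and parallel arcs. As
  \<^const>\<open>Digraph_Component.connected\<close> requires at least one vertex, connected graphs are
  nonempty.
\<close>

definition gdist :: "('a, 'b) pre_digraph \<Rightarrow> 'a \<Rightarrow> 'a \<Rightarrow> nat" where
  "gdist G u v = (LEAST k. \<exists>p. pre_digraph.awalk G u p v \<and> length p = k)"

definition ecc :: "('a, 'b) pre_digraph \<Rightarrow> 'a \<Rightarrow> nat" where
  "ecc G u = Max ((\<lambda>v. gdist G u v) ` verts G)"

definition diam :: "('a, 'b) pre_digraph \<Rightarrow> nat" where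
  "diam G = Max ((\<lambda>u. ecc G u) ` verts G)"

text \<open>
  The vertices are listed as \<open>v 0, \<dots>, v (n - 1)\<close>, since matrix indices start at \<open>0\<close>.
\<close>

definition ecc_matrix :: "('a, 'b) pre_digraph \<Rightarrow> nat \<Rightarrow> (nat \<Rightarrow> 'a) \<Rightarrow> real mat" where
  "ecc_matrix G n v = mat n n (\<lambda>(i, j).
     if gdist G (v i) (v j) = min (ecc G (v i)) (ecc G (v j))
     then real (gdist G (v i) (v j)) else 0)"

text \<open>
  A real symmetric matrix has only real eigenvalues, so the multiplicities of the real roots of
  the characteristic polynomial account for the whole spectrum. A number that is not an
  eigenvalue has multiplicity \<open>0\<close>.
\<close>

definition eigen_mult :: "real mat \<Rightarrow> real \<Rightarrow> nat" where
  "eigen_mult A x = order x (char_poly A)"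

definition inertia :: "real mat \<Rightarrow> nat \<times> nat \<times> nat" where
  "inertia A =
     (\<Sum>x | eigenvalue A x \<and> x > 0. eigen_mult A x,
      \<Sum>x | eigenvalue A x \<and> x < 0. eigen_mult A x,
      eigen_mult A 0)"

text \<open>
  This is only used for connected graphs \<open>G\<close>. The vertex of a one-vertex graph is not a
  cut-vertex: deleting it leaves no component at all, but \<^const>\<open>Digraph_Component.connected\<close>
  does not count the empty graph as connected, so that case has to be excluded explicitly.
\<close>

definition cut_vertex :: "('a, 'b) pre_digraph \<Rightarrow> 'a \<Rightarrow> bool" where
  "cut_vertex G v \<longleftrightarrow> v \<in> verts G \<and> verts G \<noteq> {v} \<and>
     \<not> Digraph_Component.connected (pre_digraph.del_vert G v)"

text \<open>
  The conjunct \<^prop>\<open>graph H\<close> restricts the sub-digraphs \<open>H\<close> of \<open>G\<close> to the symmetric ones, which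
  are the subgraphs of \<open>G\<close> as an undirected graph.
\<close>

definition is_block :: "('a, 'b) pre_digraph \<Rightarrow> ('a, 'b) pre_digraph \<Rightarrow> bool" where
  "is_block G B \<longleftrightarrow> pre_digraph.max_subgraph G
     (\<lambda>H. graph H \<and> Digraph_Component.connected H \<and> \<not> (\<exists>v. cut_vertex H v)) B"

definition bi_block_graph :: "('a, 'b) pre_digraph \<Rightarrow> bool" where
  "bi_block_graph G \<longleftrightarrow> graph G \<and> Digraph_Component.connected G \<and>
     (\<forall>B. is_block G B \<longrightarrow> (\<exists>p q. p \<ge> 1 \<and> q \<ge> 1 \<and> complete_bipartite_digraph p q B))"

definition in_class_B :: "('a, 'b) pre_digraph \<Rightarrow> bool" where
  "in_class_B G \<longleftrightarrow> bi_block_graph G \<and> card {B. is_block G B} \<ge> 2 \<and>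
     (\<forall>B. is_block G B \<longrightarrow> card {v \<in> verts B. cut_vertex G v} \<le> 2)"

end

theory Submission
  imports Defs
begin

text \<open>
  Choose vertices \<open>a\<close> and \<open>b\<close> at distance \<open>2m + 1\<close>, the middle edge of a shortest path between
  them, and the block \<open>S\<close> containing that edge. Only two vertices \<open>s, t\<close> of \<open>S\<close> are cut-vertices, so
  \<open>G\<close> is \<open>S\<close> with one branch attached at \<open>s\<close> and one at \<open>t\<close>, and distances are determined by the
  distances to \<open>s\<close> and \<open>t\<close>. This yields a set \<open>L\<close> of vertices and a height \<open>h \<le> m\<close> such that
  \<open>e(z) = h(z) + m + 1\<close> and such that the entry of \<open>E(G)\<close> at \<open>y, z\<close> is nonzero exactly if \<open>L\<close>
  separates \<open>y\<close> from \<open>z\<close> and one of them has height \<open>m\<close>, in which case it is \<open>h(y) + h(z) + 1\<close>.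
  Hence \<open>E(G)\<close> has the form \<open>a f\<^sup>T + f a\<^sup>T + g b\<^sup>T + b g\<^sup>T\<close> with \<open>a, g\<close> supported on \<open>L\<close> and \<open>f, b\<close>
  off \<open>L\<close>. By Sylvester's identity the characteristic polynomial is a power of \<open>x\<close> times a
  biquadratic polynomial in which \<open>x\<^sup>2\<close> has two distinct positive roots.
\<close>

subsection \<open>Inertia of matrices of rank four\<close>

lemma det_scalar_add_mult_commute:
  fixes U W :: "'a :: idom mat"
  assumes U: "U \<in> carrier_mat n k" and W: "W \<in> carrier_mat k n"
  shows "x ^ k * det (x \<cdot>\<^sub>m 1\<^sub>m n + U * W) = x ^ n * det (x \<cdot>\<^sub>m 1\<^sub>m k + W * U)"
proof -
  \<comment> \<open>Both sides are \<open>x ^ k * det ?N\<close>, evaluated by clearing either off-diagonal block of \<open>?N\<close>.\<close>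
  let ?N = "four_block_mat (x \<cdot>\<^sub>m 1\<^sub>m n) (- U) W (1\<^sub>m k)"
  let ?R = "four_block_mat (1\<^sub>m n) (0\<^sub>m n k) (- W) (1\<^sub>m k)"
  let ?L = "four_block_mat (1\<^sub>m n) (0\<^sub>m n k) (- W) (x \<cdot>\<^sub>m 1\<^sub>m k)"
  have N: "?N \<in> carrier_mat (n + k) (n + k)" and R: "?R \<in> carrier_mat (n + k) (n + k)"
    and L: "?L \<in> carrier_mat (n + k) (n + k)"
    using U W by auto
  have WU: "W * U \<in> carrier_mat k k" using U W by auto
  have NR: "?N * ?R = four_block_mat (x \<cdot>\<^sub>m 1\<^sub>m n + U * W) (- U) (0\<^sub>m k n) (1\<^sub>m k)"
    using U W by (subst mult_four_block_mat[where ?nr1.0 = n and ?n1.0 = n and ?n2.0 = k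
          and ?nr2.0 = k and ?nc1.0 = n and ?nc2.0 = k]) auto
  have "(x \<cdot>\<^sub>m 1\<^sub>m k) * W = x \<cdot>\<^sub>m W" using W by (subst mult_smult_assoc_mat[OF _ W]) auto
  moreover have "- W * (x \<cdot>\<^sub>m 1\<^sub>m n) = - (x \<cdot>\<^sub>m W)"
    using W by (subst mult_smult_distrib[of _ k n _ n]) (auto intro!: eq_matI)
  ultimately have LN: "?L * ?N = four_block_mat (x \<cdot>\<^sub>m 1\<^sub>m n) (- U) (0\<^sub>m k n) (x \<cdot>\<^sub>m 1\<^sub>m k + W * U)"
    using U W WU by (subst mult_four_block_mat[where ?nr1.0 = n and ?n1.0 = n and ?n2.0 = k
          and ?nr2.0 = k and ?nc1.0 = n and ?nc2.0 = k]) (auto simp: comm_add_mat[OF WU])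
  have "det ?R = 1"
    using W by (subst det_four_block_mat_upper_right_zero) auto
  moreover have "det ?L = x ^ k"
    using W by (subst det_four_block_mat_upper_right_zero) (auto simp: det_smult)
  moreover have "det (?N * ?R) = det (x \<cdot>\<^sub>m 1\<^sub>m n + U * W)"
    unfolding NR using U W by (subst det_four_block_mat_lower_left_zero) auto
  moreover have "det (?L * ?N) = x ^ n * det (x \<cdot>\<^sub>m 1\<^sub>m k + W * U)"
    unfolding LN using U W by (subst det_four_block_mat_lower_left_zero) (auto simp: det_smult)
  ultimately show ?thesis
    using det_mult[OF N R] det_mult[OF L N] by simp
qed

text \<open>The characteristic matrix of \<open>U * W\<close> is \<open>X I + (- U) W\<close> over
  the polynomial ring, so \<open>det_scalar_add_mult_commute\<close> applies with the indeterminate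
  \<open>X\<close> as scalar.\<close>

lemma char_poly_mult_commute:
  fixes U W :: "'a :: idom mat"
  assumes U: "U \<in> carrier_mat n k" and W: "W \<in> carrier_mat k n"
  shows "[:0, 1:] ^ k * char_poly (U * W) = [:0, 1:] ^ n * char_poly (W * U)"
proof -
  let ?U = "map_mat (\<lambda>a. [:- a:]) U" and ?W = "map_mat (\<lambda>a. [:a:]) W"
  have sum: "[:- (\<Sum>i\<in>A. h i):] = (\<Sum>i\<in>A. [:- h i:])" for A :: "nat set" and h :: "nat \<Rightarrow> 'a"
    by (intro poly_eqI) (auto simp: coeff_sum coeff_pCons sum_negf split: nat.splits)
  have "map_mat (\<lambda>a. [:- a:]) (U * W) = ?U * ?W"
    using U W by (intro eq_matI) (auto simp: scalar_prod_def sum mult.commute)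
  moreover have "map_mat (\<lambda>a. [:- a:]) (W * U) = ?W * ?U"
    using U W by (intro eq_matI) (auto simp: scalar_prod_def sum mult.commute)
  ultimately show ?thesis
    using det_scalar_add_mult_commute[of ?U n k ?W "[:0,1:]"] U W
    by (simp add: char_poly_def char_poly_matrix_def)
qed

section \<open>Determinants of small matrices\<close>

lemma det_2:
  assumes A: "A \<in> carrier_mat 2 2"
  shows "det A = A $$ (0,0) * A $$ (1,1) - A $$ (0,1) * A $$ (1,0)"
  using A by (subst laplace_expansion_row[OF A, of 0])
    (simp_all add: cofactor_def mat_delete_def det_single numeral_2_eq_2)

lemma det_3:
  assumes A: "A \<in> carrier_mat 3 3"
  shows "det A = A $$ (0,0) * (A $$ (1,1) * A $$ (2,2) - A $$ (1,2) * A $$ (2,1))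
    - A $$ (0,1) * (A $$ (1,0) * A $$ (2,2) - A $$ (1,2) * A $$ (2,0))
    + A $$ (0,2) * (A $$ (1,0) * A $$ (2,1) - A $$ (1,1) * A $$ (2,0))"
  using A by (subst laplace_expansion_row[OF A, of 0])
    (simp_all add: cofactor_def mat_delete_def det_2 numeral_2_eq_2 numeral_3_eq_3 algebra_simps)

text \<open>With \<open>M = [[p, k], [k, q]]\<close> and \<open>D = diag(a, c)\<close> the matrix
  has blocks \<open>x I\<close>, \<open>- M\<close>, \<open>- D\<close>, \<open>x I\<close>, so its
  determinant is that of \<open>x^2 I - M D\<close>. That only even powers of \<open>x\<close>
  survive is the source of the symmetric spectrum.\<close>

lemma det_block_antidiagonal_4:
  fixes x :: "'a :: comm_ring_1"
  shows "det (mat 4 4 (\<lambda>(i, j). [[x,0,-p,-k],[0,x,-k,-q],[-a,0,x,0],[0,-c,0,x]] ! i ! j))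
    = x^4 - (a*p + c*q) * x^2 + a * c * (p*q - k^2)"
  by (subst laplace_expansion_row[of _ 4 0])
    (simp_all add: cofactor_def mat_delete_def det_3 lessThan_Suc numeral_eq_Suc, simp add: algebra_simps)

text \<open>As a quadratic in \<open>x^2\<close> the polynomial has positive discriminant, and the
  sum \<sigma> and product \<beta> of its roots are positive; \<open>r\<close> and \<open>s\<close>
  are the square roots of these two distinct positive roots.\<close>

lemma biquadratic_factor:
  fixes \<sigma> \<beta> :: real
  assumes "0 < \<sigma>" "0 < \<beta>" "4 * \<beta> < \<sigma>\<^sup>2"
  obtains r s where "0 < r" "r < s"
    "[:\<beta>, 0, -\<sigma>, 0, 1:] = [:-r, 1:] * [:r, 1:] * ([:-s, 1:] * [:s, 1:])"
proof -
  define D where "D = sqrt (\<sigma>\<^sup>2 - 4 * \<beta>)"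
  have D: "0 < D" "D\<^sup>2 = \<sigma>\<^sup>2 - 4 * \<beta>" using assms by (auto simp: D_def)
  have "D < \<sigma>" using assms D by (intro power2_less_imp_less[of D \<sigma>]) auto
  define r where "r = sqrt ((\<sigma> - D) / 2)"
  define s where "s = sqrt ((\<sigma> + D) / 2)"
  have r2: "r * r = (\<sigma> - D) / 2" and s2: "s * s = (\<sigma> + D) / 2"
    using \<open>D < \<sigma>\<close> D assms by (auto simp: r_def s_def)
  have "0 < r" "r < s" using \<open>D < \<sigma>\<close> D by (auto simp: r_def s_def)
  moreover have "(r * r) * (s * s) = \<beta>" unfolding r2 s2 using D by (simp add: field_simps power2_eq_square)
  moreover have "r * r + s * s = \<sigma>" unfolding r2 s2 by (simp add: field_simps)
  ultimately show thesis by (intro that[of r s]) (auto simp: algebra_simps)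
qed

lemma order_linear: "order x [:- c, 1:] = (if x = c then 1 else 0)"
  for c :: real
  using order_power_n_n[of c 1] by (auto intro: order_0I)

lemma order_X_power: "order x ([:0, 1:] ^ k) = (if x = 0 then k else 0)"
  for x :: real
  using order_power_n_n[of "0::real" k] by (auto intro: order_0I)

text \<open>Orders of roots are compared on both sides of \<open>cp\<close>. At \<open>0\<close> the
  multiplicity plus \<open>4\<close> equals \<open>n\<close>, so the truncated subtraction
  \<open>n - 4\<close> loses nothing.\<close>

lemma inertia_of_char_poly:
  fixes A :: "real mat"
  assumes A: "A \<in> carrier_mat n n"
    and cp: "[:0, 1:] ^ 4 * char_poly A
      = [:0, 1:] ^ n * ([:-r, 1:] * [:r, 1:] * ([:-s, 1:] * [:s, 1:]))"
    and rs: "0 < r" "r < s"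
  shows "inertia A = (2, 2, n - 4)" "eigen_mult A \<theta> = eigen_mult A (- \<theta>)"
proof -
  let ?q = "[:-r, 1:] * [:r, 1:] * ([:-s, 1:] * [:s, 1:])"
  have q0: "?q \<noteq> 0" by (simp only: mult_eq_0_iff) simp
  have cp0: "char_poly A \<noteq> 0" using degree_monic_char_poly[OF A] by auto
  have ord_r: "order x [:r, 1:] = (if x = - r then 1 else 0)" for x r :: real
    using order_linear[of x "- r"] by simp
  have ord_q: "order x ?q = (if x \<in> {r, -r, s, -s} then 1 else 0)" for x
  proof -
    have "order x (p1 * p2 * (p3 * p4)) = order x p1 + order x p2 + (order x p3 + order x p4)"
      if "p1 * p2 * (p3 * p4) \<noteq> 0" for p1 p2 p3 p4 :: "real poly"
      using that by (simp add: order_mult)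
    from this[OF q0] show ?thesis using rs by (simp add: order_linear ord_r)
  qed
  have "[:0, 1:] ^ n * ?q \<noteq> 0"
    using q0 by (simp only: mult_eq_0_iff power_eq_0_iff) simp
  moreover from this have "[:0, 1:] ^ 4 * char_poly A \<noteq> 0" unfolding cp .
  ultimately have ord: "order x ([:0, 1:] ^ 4) + order x (char_poly A)
      = order x ([:0, 1:] ^ n) + order x ?q" for x
    using arg_cong[OF cp, of "order x"] order_mult by metis
  have mult0: "eigen_mult A 0 = n - 4"
    using ord[of 0] rs unfolding eigen_mult_def ord_q order_X_power by simp
  have mult: "eigen_mult A x = (if x \<in> {r, -r, s, -s} then 1 else 0)" if "x \<noteq> 0" for x
    using ord[of x] that unfolding eigen_mult_def ord_q order_X_power by simp
  have ev: "eigenvalue A x \<longleftrightarrow> eigen_mult A x \<noteq> 0" for x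
    unfolding eigenvalue_root_char_poly[OF A] eigen_mult_def using cp0 by (simp add: order_root)
  have pos: "{x. eigenvalue A x \<and> x > 0} = {r, s}" and neg: "{x. eigenvalue A x \<and> x < 0} = {-r, -s}"
    unfolding ev using rs by (auto simp: mult split: if_splits)
  show "inertia A = (2, 2, n - 4)"
    unfolding inertia_def pos neg mult0 using rs by (auto simp: mult)
  show "eigen_mult A \<theta> = eigen_mult A (- \<theta>)"
    using rs by (cases "\<theta> = 0") (auto simp: mult)
qed

text \<open>The orthogonality relations bring the reduced matrix to the shape of
  \<open>det_block_antidiagonal_4\<close>, with \<open>M\<close> the Gram matrix of
  \<open>f, b\<close>. Strict Cauchy-Schwarz makes the constant coefficient positive; a nonzero
  inner product of \<open>f\<close> and \<open>b\<close> makes the two roots in \<open>x^2\<close>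
  distinct.\<close>

lemma inertia_rank_4:
  fixes n :: nat and a b f g :: "nat \<Rightarrow> real"
  defines "A \<equiv> mat n n (\<lambda>(i, j). a i * f j + g i * b j + f i * a j + b i * g j)"
  assumes orth: "\<And>i. i < n \<Longrightarrow> a i * f i = 0" "\<And>i. i < n \<Longrightarrow> a i * b i = 0"
      "\<And>i. i < n \<Longrightarrow> a i * g i = 0" "\<And>i. i < n \<Longrightarrow> g i * f i = 0" "\<And>i. i < n \<Longrightarrow> g i * b i = 0"
    and pos: "0 < (\<Sum>i<n. (a i)\<^sup>2)" "0 < (\<Sum>i<n. (g i)\<^sup>2)" "(\<Sum>i<n. f i * b i) \<noteq> 0"
    and cs: "(\<Sum>i<n. f i * b i)\<^sup>2 < (\<Sum>i<n. (f i)\<^sup>2) * (\<Sum>i<n. (b i)\<^sup>2)"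
  shows "inertia A = (2, 2, n - 4)" "eigen_mult A \<theta> = eigen_mult A (- \<theta>)"
proof -
  define \<alpha> \<gamma> \<phi> \<nu> \<kappa> where "\<alpha> = (\<Sum>i<n. (a i)\<^sup>2)" and "\<gamma> = (\<Sum>i<n. (g i)\<^sup>2)"
    and "\<phi> = (\<Sum>i<n. (f i)\<^sup>2)" and "\<nu> = (\<Sum>i<n. (b i)\<^sup>2)" and "\<kappa> = (\<Sum>i<n. f i * b i)"
  note greek = \<alpha>_def \<gamma>_def \<phi>_def \<nu>_def \<kappa>_def
  have posg: "0 < \<alpha>" "0 < \<gamma>" "\<kappa> \<noteq> 0" "\<kappa>\<^sup>2 < \<phi> * \<nu>" using pos cs by (auto simp: greek)
  \<comment> \<open>\<open>A = U * W\<close>, and the entries of the \<open>4 \<times> 4\<close> matrix \<open>W * U\<close> are inner products of \<open>a, g, f, b\<close>.\<close>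
  define U where "U = mat n 4 (\<lambda>(i, j). [a i, g i, f i, b i] ! j)"
  define W where "W = mat 4 n (\<lambda>(i, j). [f j, b j, a j, g j] ! i)"
  have U: "U \<in> carrier_mat n 4" and W: "W \<in> carrier_mat 4 n" by (auto simp: U_def W_def)
  have "A = U * W"
    by (rule eq_matI) (auto simp: A_def U_def W_def scalar_prod_def numeral_eq_Suc)
  have WU: "(W * U) $$ (i, j) = (\<Sum>l<n. [f l, b l, a l, g l] ! i * [a l, g l, f l, b l] ! j)"
    if "i < 4" "j < 4" for i j
    using that by (auto simp: U_def W_def scalar_prod_def lessThan_atLeast0)
  have zero: "(\<Sum>l<n. f l * a l) = 0" "(\<Sum>l<n. f l * g l) = 0" "(\<Sum>l<n. b l * a l) = 0"
    "(\<Sum>l<n. b l * g l) = 0" "(\<Sum>l<n. a l * g l) = 0" "(\<Sum>l<n. g l * a l) = 0"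
    "(\<Sum>l<n. a l * f l) = 0" "(\<Sum>l<n. a l * b l) = 0" "(\<Sum>l<n. g l * f l) = 0"
    "(\<Sum>l<n. g l * b l) = 0"
    by (rule sum.neutral; use orth in \<open>metis lessThan_iff mult.commute\<close>)+
  have entry: "char_poly_matrix (W * U) $$ (i, j) = (if i = j then [:0, 1:] else 0)
      + [:- (\<Sum>l<n. [f l, b l, a l, g l] ! i * [a l, g l, f l, b l] ! j):]"
    if "i < 4" "j < 4" for i j
    using that U W unfolding WU[OF that, symmetric] by (auto simp: char_poly_matrix_def)
  have "char_poly_matrix (W * U) = mat 4 4 (\<lambda>(i, j).
      [[[:0, 1:], 0, - [:\<phi>:], - [:\<kappa>:]], [0, [:0, 1:], - [:\<kappa>:], - [:\<nu>:]],
       [- [:\<alpha>:], 0, [:0, 1:], 0], [0, - [:\<gamma>:], 0, [:0, 1:]]] ! i ! j)" (is "_ = ?M")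
  proof (rule eq_matI)
    fix i j assume "i < dim_row ?M" "j < dim_col ?M"
    then have ij: "i < 4" "j < 4" by auto
    have "i \<in> {0, 1, 2, 3}" "j \<in> {0, 1, 2, 3}" using ij by auto
    then show "char_poly_matrix (W * U) $$ (i, j) = ?M $$ (i, j)"
      unfolding entry[OF ij] using ij
      by (auto simp: zero greek power2_eq_square mult.commute[of "b _" "f _"])
  qed (use W U in \<open>auto simp: char_poly_matrix_def\<close>)
  then have "char_poly (W * U) = [:0, 1:] ^ 4 - ([:\<alpha>:] * [:\<phi>:] + [:\<gamma>:] * [:\<nu>:]) * [:0, 1:]\<^sup>2
      + [:\<alpha>:] * [:\<gamma>:] * ([:\<phi>:] * [:\<nu>:] - [:\<kappa>:]\<^sup>2)"
    unfolding char_poly_def by (simp only: det_block_antidiagonal_4)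
  also have "\<dots> = [:\<alpha> * \<gamma> * (\<phi> * \<nu> - \<kappa>\<^sup>2), 0, - (\<alpha> * \<phi> + \<gamma> * \<nu>), 0, 1:]"
    by (simp add: numeral_eq_Suc algebra_simps)
  finally have cp: "char_poly (W * U) = \<dots>" .
  have "0 \<le> \<phi>" "0 \<le> \<nu>" by (auto simp: greek intro: sum_nonneg)
  moreover have "0 < \<phi> * \<nu>" using posg by (smt (verit) zero_le_power2)
  ultimately have "0 < \<phi>" "0 < \<nu>" by (auto simp: zero_less_mult_iff)
  then have "0 < \<alpha> * \<phi> + \<gamma> * \<nu>" "0 < \<alpha> * \<gamma> * (\<phi> * \<nu> - \<kappa>\<^sup>2)"
    using posg by (auto intro!: add_pos_pos)
  moreover have "4 * (\<alpha> * \<gamma> * (\<phi> * \<nu> - \<kappa>\<^sup>2)) < (\<alpha> * \<phi> + \<gamma> * \<nu>)\<^sup>2"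
  proof -
    have "(\<alpha> * \<phi> + \<gamma> * \<nu>)\<^sup>2 - 4 * (\<alpha> * \<gamma> * (\<phi> * \<nu> - \<kappa>\<^sup>2))
        = (\<alpha> * \<phi> - \<gamma> * \<nu>)\<^sup>2 + 4 * (\<alpha> * \<gamma> * \<kappa>\<^sup>2)"
      by (simp add: power2_eq_square algebra_simps)
    moreover have "0 < 4 * (\<alpha> * \<gamma> * \<kappa>\<^sup>2)" using posg by simp
    ultimately show ?thesis by (smt (verit) zero_le_power2)
  qed
  ultimately obtain r s where rs: "0 < r" "r < s"
    and q: "char_poly (W * U) = [:-r, 1:] * [:r, 1:] * ([:-s, 1:] * [:s, 1:])"
    using biquadratic_factor cp by metis
  have "[:0, 1:] ^ 4 * char_poly A
      = [:0, 1:] ^ n * ([:-r, 1:] * [:r, 1:] * ([:-s, 1:] * [:s, 1:]))"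
    using char_poly_mult_commute[OF U W] unfolding \<open>A = U * W\<close> q .
  moreover have "A \<in> carrier_mat n n" by (simp add: A_def)
  ultimately show "inertia A = (2, 2, n - 4)" "eigen_mult A \<theta> = eigen_mult A (- \<theta>)"
    using inertia_of_char_poly rs by blast+
qed

subsection \<open>Eccentricity matrices with nonzero entries between two sides\<close>

text \<open>
  The slack \<open>max 2\<close> is needed because two vertices of height \<open>0\<close> on the same side may be opposite
  vertices of a 4-cycle in the central block; it does no harm as all eccentricities exceed \<open>2\<close>.
\<close>

lemma inertia_ecc_matrix_of_layers:
  fixes G :: "('a, 'b) pre_digraph" and h :: "'a \<Rightarrow> nat" and L :: "'a set"
  assumes bij: "bij_betw v {..<n} (verts G)" and m: "m \<ge> 2"
    and h: "\<And>z. z \<in> verts G \<Longrightarrow> h z \<le> m"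
    and sym: "\<And>y z. y \<in> verts G \<Longrightarrow> z \<in> verts G \<Longrightarrow> gdist G y z = gdist G z y"
    and same: "\<And>y z. y \<in> verts G \<Longrightarrow> z \<in> verts G \<Longrightarrow> y \<in> L \<longleftrightarrow> z \<in> L \<Longrightarrow> gdist G y z \<le> max 2 (h y + h z)"
    and cross: "\<And>y z. y \<in> verts G \<inter> L \<Longrightarrow> z \<in> verts G - L \<Longrightarrow> gdist G y z \<le> max 2 (h y + h z + 1)"
    and cross_eq: "\<And>y z. y \<in> verts G \<inter> L \<Longrightarrow> z \<in> verts G - L \<Longrightarrow> h y = m \<or> h z = m
      \<Longrightarrow> gdist G y z = h y + h z + 1"
    and x0: "x0 \<in> verts G \<inter> L" "h x0 = 0" and xm: "xm \<in> verts G \<inter> L" "h xm = m"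
    and y0: "y0 \<in> verts G - L" "h y0 = 0" and ym: "ym \<in> verts G - L" "h ym = m"
  shows "inertia (ecc_matrix G n v) = (2, 2, n - 4)"
    "eigen_mult (ecc_matrix G n v) \<theta> = eigen_mult (ecc_matrix G n v) (- \<theta>)"
proof -
  let ?V = "verts G"
  have fin: "finite ?V" using bij bij_betw_finite by blast
  have ecc: "ecc G z = h z + m + 1" if z: "z \<in> ?V" for z
  proof -
    have "gdist G z y \<le> h z + m + 1" if y: "y \<in> ?V" for y
    proof (cases "z \<in> L \<longleftrightarrow> y \<in> L")
      case True
      then show ?thesis using same[OF z y] h[OF y] m by auto
    next
      case False
      have "gdist G z y \<le> max 2 (h z + h y + 1)"
        using False cross[of z y] cross[of y z] sym[of y z] z y by (cases "z \<in> L") (auto simp: add.commute)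
      then show ?thesis using h[OF y] m by auto
    qed
    \<comment> \<open>The maximum is attained at the given vertex of height \<open>m\<close> on the
      other side of \<open>L\<close>.\<close>
    moreover have "h z + m + 1 \<in> (\<lambda>y. gdist G z y) ` ?V"
    proof (cases "z \<in> L")
      case True
      then have "gdist G z ym = h z + m + 1" using cross_eq[of z ym] z ym by auto
      then show ?thesis using ym by force
    next
      case False
      then have "gdist G z xm = h z + m + 1" using cross_eq[of xm z] sym[of z xm] z xm by auto
      then show ?thesis using xm by force
    qed
    ultimately show ?thesis unfolding ecc_def using fin by (intro Max_eqI) auto
  qed
  \<comment> \<open>\<open>a\<close> and \<open>b\<close> mark the vertices of height
    \<open>m\<close> on either side; \<open>f\<close> and \<open>g\<close> carry the entries. The
    condition \<open>h z \<noteq> m\<close> in \<open>g\<close> keeps pairs with both heights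
    \<open>m\<close> from being counted twice.\<close>
  define a where "a z = (if z \<in> L \<and> h z = m then 1 else 0 :: real)" for z
  define b where "b z = (if z \<notin> L \<and> h z = m then 1 else 0 :: real)" for z
  define f where "f z = (if z \<notin> L then real (h z + m + 1) else 0)" for z
  define g where "g z = (if z \<in> L \<and> h z \<noteq> m then real (h z + m + 1) else 0)" for z
  note abfg = a_def b_def f_def g_def
  define e where "e y z = (if gdist G y z = min (ecc G y) (ecc G z) then real (gdist G y z) else 0)" for y z
  have e_sym: "e y z = e z y" if "y \<in> ?V" "z \<in> ?V" for y z
    using sym[OF that] by (auto simp: e_def min.commute)
  have e_cross: "e y z = a y * f z + g y * b z" if yz: "y \<in> ?V \<inter> L" "z \<in> ?V - L" for y z
  proof (cases "h y = m \<or> h z = m")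
    case True
    then have "gdist G y z = min (ecc G y) (ecc G z)"
      using cross_eq[OF yz] yz ecc h[of y] h[of z] by auto
    then show ?thesis using cross_eq[OF yz True] True yz by (auto simp: abfg e_def)
  next
    case False
    then have "h y < m" "h z < m" using h[of y] h[of z] yz by auto
    \<comment> \<open>Heights below \<open>m\<close> make \<open>h y + h z + 1\<close> smaller than
      both eccentricities, and \<open>m \<ge> 2\<close> takes care of the slack.\<close>
    then have "gdist G y z \<noteq> min (ecc G y) (ecc G z)"
      using cross[OF yz] yz ecc m by auto
    then show ?thesis using False by (auto simp: abfg e_def)
  qed
  have e_entry: "e y z = a y * f z + g y * b z + f y * a z + b y * g z" if yz: "y \<in> ?V" "z \<in> ?V" for y z
  proof (cases "y \<in> L \<longleftrightarrow> z \<in> L")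
    case True
    then have "gdist G y z \<noteq> min (ecc G y) (ecc G z)"
      using same[OF yz True] ecc yz h[of y] h[of z] m by auto
    then show ?thesis using True by (auto simp: abfg e_def)
  next
    case False
    then show ?thesis
      using e_cross[of y z] e_cross[of z y] e_sym[OF yz] yz by (cases "y \<in> L") (auto simp: abfg)
  qed
  have vV: "v i \<in> ?V" if "i < n" for i using bij that by (auto simp: bij_betw_def)
  have A: "ecc_matrix G n v = mat n n (\<lambda>(i, j). a (v i) * f (v j) + g (v i) * b (v j)
      + f (v i) * a (v j) + b (v i) * g (v j))"
    unfolding ecc_matrix_def using e_entry vV by (intro cong_mat) (auto simp: e_def)
  have sums: "(\<Sum>i<n. F (v i)) = (\<Sum>z\<in>?V. F z)" for F :: "'a \<Rightarrow> real"
    using sum.reindex_bij_betw[OF bij] .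
  define \<nu> where "\<nu> = (\<Sum>z\<in>?V. (b z)\<^sup>2)"
  have a_pos: "0 < (\<Sum>z\<in>?V. (a z)\<^sup>2)"
    using fin xm by (intro sum_pos2[of _ xm]) (auto simp: a_def)
  have g_pos: "0 < (\<Sum>z\<in>?V. (g z)\<^sup>2)"
    using fin x0 m by (intro sum_pos2[of _ x0]) (auto simp: g_def)
  have b_pos: "0 < \<nu>"
    unfolding \<nu>_def using fin ym by (intro sum_pos2[of _ ym]) (auto simp: b_def)
  have fb: "(\<Sum>z\<in>?V. f z * b z) = (2 * m + 1) * \<nu>"
    unfolding \<nu>_def sum_distrib_left by (intro sum.cong) (auto simp: f_def b_def)
  \<comment> \<open>\<open>f\<close> equals \<open>2 * m + 1\<close> on the support of
    \<open>b\<close>, and \<open>y0\<close>, of height \<open>0\<close>, contributes to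
    \<open>f\<close> but not to \<open>b\<close>. This makes Cauchy-Schwarz strict.\<close>
  have "(2 * m + 1)\<^sup>2 * \<nu> < (\<Sum>z\<in>?V. (f z)\<^sup>2)"
    unfolding \<nu>_def sum_distrib_left
  proof (rule sum_strict_mono_ex1[OF fin])
    show "\<forall>z\<in>?V. (2 * m + 1)\<^sup>2 * (b z)\<^sup>2 \<le> (f z)\<^sup>2" by (auto simp: f_def b_def)
    show "\<exists>z\<in>?V. (2 * m + 1)\<^sup>2 * (b z)\<^sup>2 < (f z)\<^sup>2"
      using y0 m by (intro bexI[of _ y0]) (auto simp: f_def b_def)
  qed
  from mult_strict_right_mono[OF this b_pos]
  have cs: "(\<Sum>z\<in>?V. f z * b z)\<^sup>2 < (\<Sum>z\<in>?V. (f z)\<^sup>2) * \<nu>"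
    unfolding fb by (simp add: power2_eq_square algebra_simps)
  note sums' = sums[of "\<lambda>z. (a z)\<^sup>2"] sums[of "\<lambda>z. (g z)\<^sup>2"] sums[of "\<lambda>z. (f z)\<^sup>2"]
    sums[of "\<lambda>z. (b z)\<^sup>2", folded \<nu>_def] sums[of "\<lambda>z. f z * b z"]
  have fb_nz: "(\<Sum>z\<in>?V. f z * b z) \<noteq> 0" unfolding fb using b_pos by simp
  have orth: "a z * f z = 0" "a z * b z = 0" "a z * g z = 0" "g z * f z = 0" "g z * b z = 0" for z
    by (auto simp: abfg)
  show "inertia (ecc_matrix G n v) = (2, 2, n - 4)"
    "eigen_mult (ecc_matrix G n v) \<theta> = eigen_mult (ecc_matrix G n v) (- \<theta>)"
    unfolding A by (intro inertia_rank_4; simp only: sums' orth cs a_pos g_pos fb_nz not_False_eq_True)+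
qed

subsection \<open>Nonseparable vertex sets\<close>

text \<open>Paths are confined to \<open>S\<close> by \<open>rtrancl_on\<close>, so deleting a
  vertex is a set difference and needs no new digraph. The empty set is excluded in agreement with
  \<open>Digraph_Component.connected\<close>.\<close>

definition connected_on :: "('a \<times> 'a) set \<Rightarrow> 'a set \<Rightarrow> bool" where
  "connected_on E S \<longleftrightarrow> S \<noteq> {} \<and> (\<forall>u\<in>S. \<forall>v\<in>S. (u, v) \<in> rtrancl_on S E)"

definition nonseparable_on :: "('a \<times> 'a) set \<Rightarrow> 'a set \<Rightarrow> bool" where
  "nonseparable_on E S \<longleftrightarrow> connected_on E S \<and> (\<forall>c\<in>S. S \<noteq> {c} \<longrightarrow> connected_on E (S - {c}))"

lemma connected_on_mono: "connected_on E S \<Longrightarrow> E \<subseteq> F \<Longrightarrow> connected_on F S"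
  unfolding connected_on_def by (meson rtrancl_on_mono subset_refl)

lemma nonseparable_on_mono: "nonseparable_on E S \<Longrightarrow> E \<subseteq> F \<Longrightarrow> nonseparable_on F S"
  unfolding nonseparable_on_def by (meson connected_on_mono)

lemma rtrancl_on_Int_Times: "rtrancl_on S (E \<inter> T \<times> T) = rtrancl_on S E" if "S \<subseteq> T"
proof -
  have "(a, b) \<in> rtrancl_on S (E \<inter> T \<times> T)" if "(a, b) \<in> rtrancl_on S E" for a b
    using that \<open>S \<subseteq> T\<close> by induct (auto intro: converse_rtrancl_on_into_rtrancl_on)
  moreover have "(a, b) \<in> rtrancl_on S E" if "(a, b) \<in> rtrancl_on S (E \<inter> T \<times> T)" for a b
    using that by (rule rtrancl_on_mono[rotated 2]) auto
  ultimately show ?thesis by auto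
qed

lemma connected_on_Int_Times: "S \<subseteq> T \<Longrightarrow> connected_on (E \<inter> T \<times> T) S = connected_on E S"
  unfolding connected_on_def by (simp add: rtrancl_on_Int_Times)

lemma nonseparable_on_Int_Times: "nonseparable_on (E \<inter> S \<times> S) S = nonseparable_on E S"
  unfolding nonseparable_on_def by (simp add: connected_on_Int_Times[of _ S])

lemma connected_on_singleton: "connected_on E {x}"
  by (auto simp: connected_on_def)

lemma connected_on_Un:
  assumes "sym E" and A: "connected_on E A" and P: "connected_on E P"
    and edge: "a \<in> A" "p \<in> P" "(a, p) \<in> E"
  shows "connected_on E (A \<union> P)"
proof -
  let ?R = "rtrancl_on (A \<union> P) E"
  have symR: "(v, u) \<in> ?R" if "(u, v) \<in> ?R" for u v
    using rtrancl_on_sym[OF \<open>sym E\<close>] that by (meson symD)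
  have "(a, p) \<in> ?R"
    using edge by (auto intro: rtrancl_on_into_rtrancl_on[OF rtrancl_on_refl])
  then have "(p, a) \<in> ?R" by (rule symR)
  have "(u, a) \<in> ?R" if "u \<in> A \<union> P" for u
    using that
  proof
    assume "u \<in> A"
    then have "(u, a) \<in> rtrancl_on A E" using A edge by (auto simp: connected_on_def)
    then show ?thesis by (rule rtrancl_on_mono[rotated 2]) auto
  next
    assume "u \<in> P"
    then have "(u, p) \<in> rtrancl_on P E" using P edge by (auto simp: connected_on_def)
    then have "(u, p) \<in> ?R" by (rule rtrancl_on_mono[rotated 2]) auto
    then show ?thesis using \<open>(p, a) \<in> ?R\<close> by (rule rtrancl_on_trans)
  qed
  then have "(u, v) \<in> ?R" if "u \<in> A \<union> P" "v \<in> A \<union> P" for u v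
    using rtrancl_on_trans[of u a "A \<union> P" E v] symR that by auto
  then show ?thesis using edge unfolding connected_on_def by auto
qed

lemma connected_on_successively:
  assumes "sym E" "xs \<noteq> []" "successively (\<lambda>x y. (x, y) \<in> E) xs"
  shows "connected_on E (set xs)"
  using assms(2,3)
proof (induction xs rule: induct_list012)
  case (3 x y zs)
  then show ?case using connected_on_Un[OF assms(1) connected_on_singleton, of "set (y # zs)" x x y]
    by (auto simp: insert_commute)
qed (auto simp: connected_on_singleton)

lemma rtrancl_on_path:
  assumes "(a, b) \<in> rtrancl_on S E"
  obtains xs where "xs \<noteq> []" "hd xs = a" "last xs = b" "distinct xs" "set xs \<subseteq> S"
    "successively (\<lambda>x y. (x, y) \<in> E) xs"
proof -
  from assms have "\<exists>xs. xs \<noteq> [] \<and> hd xs = a \<and> last xs = b \<and> distinct xs \<and> set xs \<subseteq> S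
    \<and> successively (\<lambda>x y. (x, y) \<in> E) xs"
  proof (induct rule: converse_rtrancl_on_induct)
    case base
    then show ?case by (intro exI[of _ "[b]"]) auto
  next
    case (step x y)
    then obtain xs where xs: "xs \<noteq> []" "hd xs = y" "last xs = b" "distinct xs" "set xs \<subseteq> S"
      "successively (\<lambda>x y. (x, y) \<in> E) xs" by auto
    show ?case
    proof (cases "x \<in> set xs")
      case True
      \<comment> \<open>The path already passes through \<open>x\<close>, so its part from there on
        serves.\<close>
      then obtain us vs where "xs = us @ x # vs" by (auto simp: in_set_conv_decomp)
      then show ?thesis
        using xs by (intro exI[of _ "x # vs"]) (auto simp: successively_append_iff)
    next
      case False
      then show ?thesis
        using xs step by (intro exI[of _ "x # xs"]) (auto simp: successively_Cons)
    qed
  qed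
  then show thesis using that by blast
qed

lemma rtrancl_on_exit:
  assumes "(a, b) \<in> rtrancl_on S E" "a \<in> D" "b \<notin> D"
  obtains x y where "(x, y) \<in> E" "x \<in> D \<inter> S" "y \<in> S - D"
  using assms by (induct rule: rtrancl_on_induct) auto

text \<open>Deleting a vertex of \<open>S\<close> leaves at least one of \<open>u\<close> and
  \<open>w\<close> to hold the ear \<open>xs\<close>; deleting a vertex of the ear leaves a front
  piece held at \<open>u\<close> and a rear piece held at \<open>w\<close>.\<close>

lemma nonseparable_on_ear:
  assumes "sym E" and S: "nonseparable_on E S" and xs: "xs \<noteq> []" "distinct xs" "set xs \<inter> S = {}"
      "successively (\<lambda>x y. (x, y) \<in> E) xs"
    and u: "u \<in> S" "(u, hd xs) \<in> E" and w: "w \<in> S" "(w, last xs) \<in> E" and "u \<noteq> w"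
  shows "nonseparable_on E (S \<union> set xs)"
proof -
  have conn_xs: "connected_on E (set xs)" using connected_on_successively[OF \<open>sym E\<close>] xs by auto
  have attach: "connected_on E (A \<union> set xs)" if "connected_on E A" "u \<in> A \<or> w \<in> A" for A
    using that connected_on_Un[OF \<open>sym E\<close> that(1) conn_xs] u w xs by (metis hd_in_set last_in_set)
  have "connected_on E (S \<union> set xs)"
    using attach S u unfolding nonseparable_on_def by auto
  moreover have "connected_on E (S \<union> set xs - {c})" if "c \<in> S \<union> set xs" for c
  proof (cases "c \<in> S")
    case True
    then have "connected_on E (S - {c})" using S u w \<open>u \<noteq> w\<close> unfolding nonseparable_on_def by auto
    moreover have "S \<union> set xs - {c} = (S - {c}) \<union> set xs" using xs True by auto
    ultimately show ?thesis using attach[of "S - {c}"] u w \<open>u \<noteq> w\<close> by auto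
  next
    case False
    then have "c \<in> set xs" using that by auto
    then obtain as bs where dec: "xs = as @ c # bs" by (meson split_list)
    have as: "connected_on E (S \<union> set as)"
    proof (cases "as = []")
      case True
      then show ?thesis using S by (auto simp: nonseparable_on_def)
    next
      case ne: False
      then have "connected_on E (set as)"
        using connected_on_successively[OF \<open>sym E\<close>] xs dec by (auto simp: successively_append_iff)
      moreover have "hd xs \<in> set as" using ne dec by (auto)
      ultimately show ?thesis
        using connected_on_Un[OF \<open>sym E\<close>, of S "set as" u "hd xs"] S u by (auto simp: nonseparable_on_def)
    qed
    have "connected_on E (S \<union> set as \<union> set bs)"
    proof (cases "bs = []")
      case True
      then show ?thesis using as by auto
    next
      case ne: False
      then have "connected_on E (set bs)"
        using connected_on_successively[OF \<open>sym E\<close>] xs dec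
        by (auto simp: successively_append_iff successively_Cons)
      moreover have "last xs \<in> set bs" using ne dec by auto
      ultimately show ?thesis
        using connected_on_Un[OF \<open>sym E\<close> as, of "set bs" w "last xs"] w by auto
    qed
    moreover have "S \<union> set xs - {c} = S \<union> set as \<union> set bs" using dec xs False by auto
    ultimately show ?thesis by simp
  qed
  ultimately show ?thesis unfolding nonseparable_on_def by auto
qed

section \<open>From symmetric digraphs to vertex sets with an adjacency relation\<close>

lemma arcs_ends_induce_subgraph: "arcs_ends (G \<restriction> S) = arcs_ends G \<inter> S \<times> S"
  by (auto simp: arcs_ends_conv)

lemma symcl_symmetric: "symmetric H \<Longrightarrow> (arcs_ends H)\<^sup>s = arcs_ends H"
  unfolding symmetric_def symcl_def by (auto dest: symD)

lemma connected_iff_connected_on: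
  "symmetric H \<Longrightarrow> Digraph_Component.connected H \<longleftrightarrow> connected_on (arcs_ends H) (verts H)"
  unfolding connected_conv connected_on_def by (simp add: symcl_symmetric)

lemma del_vert_eq_induce_subgraph:
  assumes "wf_digraph H"
  shows "pre_digraph.del_vert H c = H \<restriction> (verts H - {c})"
  using assms by (auto simp: pre_digraph.del_vert_def induce_subgraph_def wf_digraph_def)

lemma cut_vertex_iff_connected_on:
  assumes "graph H"
  shows "cut_vertex H c \<longleftrightarrow> c \<in> verts H \<and> verts H \<noteq> {c} \<and> \<not> connected_on (arcs_ends H) (verts H - {c})"
proof -
  interpret graph H by fact
  have "symmetric (H \<restriction> (verts H - {c}))"
    using induced_graph_imp_symmetric[OF sym_arcs, of "H \<restriction> (verts H - {c})"]
      induced_induce[of "verts H - {c}"] by auto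
  then show ?thesis
    unfolding cut_vertex_def del_vert_eq_induce_subgraph[OF wf_digraph]
    by (simp add: connected_iff_connected_on arcs_ends_induce_subgraph connected_on_Int_Times)
qed

lemma connected_no_cut_vertex_iff:
  assumes "graph H"
  shows "Digraph_Component.connected H \<and> \<not> (\<exists>c. cut_vertex H c) \<longleftrightarrow> nonseparable_on (arcs_ends H) (verts H)"
proof -
  interpret graph H by fact
  show ?thesis
    unfolding nonseparable_on_def cut_vertex_iff_connected_on[OF assms]
    using connected_iff_connected_on[OF sym_arcs] by auto
qed

subsection \<open>Distances and blocks\<close>

locale connected_graph = graph +
  assumes connected: "Digraph_Component.connected G"
begin

abbreviation "V \<equiv> verts G"
abbreviation "E \<equiv> arcs_ends G"
abbreviation "d \<equiv> gdist G"

lemma sym_E: "sym E"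
  using sym_arcs by (simp add: symmetric_def)

lemma E_in_verts: "(u, v) \<in> E \<Longrightarrow> u \<in> V \<and> v \<in> V"
  by (auto simp: arcs_ends_conv)

lemma connected_on_V: "connected_on E V"
  using connected connected_iff_connected_on[OF sym_arcs] by simp

lemma awalk_length_iff_relpow: "u \<in> V \<Longrightarrow> (\<exists>p. awalk u p v \<and> length p = k) \<longleftrightarrow> (u, v) \<in> E ^^ k"
proof (induction k arbitrary: u)
  case 0
  then show ?case by (auto simp: awalk_Nil_iff)
next
  case (Suc k)
  show ?case
  proof
    assume "\<exists>p. awalk u p v \<and> length p = Suc k"
    then obtain e p where "awalk u (e # p) v" "length p = k" by (auto simp: length_Suc_conv)
    then have "(u, head G e) \<in> E" "(head G e, v) \<in> E ^^ k"
      using Suc.IH[of "head G e"] by (auto simp: awalk_Cons_iff arcs_ends_conv)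
    then show "(u, v) \<in> E ^^ Suc k" by (rule relpow_Suc_I2)
  next
    assume "(u, v) \<in> E ^^ Suc k"
    then obtain w where "(u, w) \<in> E" "(w, v) \<in> E ^^ k" by (rule relpow_Suc_E2)
    then obtain e p where e: "e \<in> arcs G" "u = tail G e" "w = head G e" and p: "awalk w p v" "length p = k"
      using Suc.IH[of w] by (auto simp: arcs_ends_conv)
    then have "awalk u (e # p) v \<and> length (e # p) = Suc k" by (auto simp: awalk_Cons_iff)
    then show "\<exists>p. awalk u p v \<and> length p = Suc k" by blast
  qed
qed

lemma gdist_eq_Least: "u \<in> V \<Longrightarrow> d u v = (LEAST k. (u, v) \<in> E ^^ k)"
  unfolding gdist_def by (simp add: awalk_length_iff_relpow)

lemma gdist_le: "u \<in> V \<Longrightarrow> (u, v) \<in> E ^^ k \<Longrightarrow> d u v \<le> k"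
  by (simp add: gdist_eq_Least Least_le)

lemma relpow_gdist: "u \<in> V \<Longrightarrow> v \<in> V \<Longrightarrow> (u, v) \<in> E ^^ d u v"
proof -
  assume uv: "u \<in> V" "v \<in> V"
  then have "(u, v) \<in> E\<^sup>*"
    using connected_on_V rtrancl_on_rtranclI[of u v V E] by (auto simp: connected_on_def)
  then obtain k where "(u, v) \<in> E ^^ k" using rtrancl_power by blast
  then show ?thesis unfolding gdist_eq_Least[OF uv(1)] by (rule LeastI)
qed

lemma relpow_sym: "(u, v) \<in> E ^^ k \<Longrightarrow> (v, u) \<in> E ^^ k"
proof (induction k arbitrary: u)
  case (Suc k)
  then obtain w where "(u, w) \<in> E" "(w, v) \<in> E ^^ k" by (meson relpow_Suc_D2)
  then show ?case using Suc.IH sym_E by (meson relpow_Suc_I symD)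
qed auto

lemma gdist_sym: "u \<in> V \<Longrightarrow> v \<in> V \<Longrightarrow> d u v = d v u"
  using gdist_le[OF _ relpow_sym[OF relpow_gdist, of u v]]
    gdist_le[OF _ relpow_sym[OF relpow_gdist, of v u]]
  by (simp add: antisym)

lemma gdist_triangle: "u \<in> V \<Longrightarrow> v \<in> V \<Longrightarrow> w \<in> V \<Longrightarrow> d u w \<le> d u v + d v w"
  by (rule gdist_le) (simp_all add: relpow_add relcompI[OF relpow_gdist relpow_gdist])

lemma gdist_eq_0_iff: "u \<in> V \<Longrightarrow> v \<in> V \<Longrightarrow> d u v = 0 \<longleftrightarrow> u = v"
  using gdist_le[of u u 0] relpow_gdist[of u v] by auto

lemma gdist_self [simp]: "u \<in> V \<Longrightarrow> d u u = 0"
  by (simp add: gdist_eq_0_iff)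

lemma gdist_eq_1_iff: "u \<in> V \<Longrightarrow> v \<in> V \<Longrightarrow> d u v = 1 \<longleftrightarrow> (u, v) \<in> E"
proof
  assume uv: "u \<in> V" "v \<in> V" and "d u v = 1"
  then show "(u, v) \<in> E" using relpow_gdist[of u v] by simp
next
  assume uv: "u \<in> V" "v \<in> V" and e: "(u, v) \<in> E"
  then have "u \<noteq> v" using adj_not_same by auto
  then have "d u v \<noteq> 0" using gdist_eq_0_iff uv by simp
  moreover have "d u v \<le> 1" using gdist_le[of u v 1] uv e by simp
  ultimately show "d u v = 1" by simp
qed

text \<open>A shortest walk is cut after \<open>i\<close> steps; the triangle inequality prevents
  either part from being shortened.\<close>

lemma gdist_split:
  assumes "u \<in> V" "v \<in> V" "d u v = i + j"
  obtains w where "w \<in> V" "d u w = i" "d w v = j"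
proof -
  have "(u, v) \<in> E ^^ (i + j)" using relpow_gdist[OF assms(1,2)] assms(3) by simp
  then obtain w where w: "(u, w) \<in> E ^^ i" "(w, v) \<in> E ^^ j" by (auto simp: relpow_add)
  have "w \<in> V" using w(1) E_in_verts assms(1) by (cases i) auto
  moreover have "d u w \<le> i" "d w v \<le> j" using w gdist_le assms \<open>w \<in> V\<close> by auto
  moreover have "d u v \<le> d u w + d w v" using gdist_triangle assms \<open>w \<in> V\<close> by blast
  ultimately show thesis using that assms(3) by auto
qed

text \<open>Since \<open>K\<close> can be left only through \<open>w\<close>, a shortest walk from
  \<open>z\<close> stays in \<open>K\<close> until it meets \<open>w\<close>; the induction moves
  \<open>z\<close> one step along it.\<close>

lemma gdist_separated:
  assumes w: "w \<in> V" and sep: "\<And>p q. (p, q) \<in> E \<Longrightarrow> p \<in> K \<Longrightarrow> q \<notin> K \<Longrightarrow> p = w"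
    and "z \<in> K" "z \<in> V" "y \<in> V" "y \<notin> K"
  shows "d z y = d z w + d w y"
  using \<open>z \<in> K\<close> \<open>z \<in> V\<close>
proof (induction "d z y" arbitrary: z)
  case 0
  then show ?case using gdist_eq_0_iff[of z y] \<open>y \<in> V\<close> \<open>y \<notin> K\<close> by auto
next
  case (Suc k)
  show ?case
  proof (cases "z = w")
    case True
    then show ?thesis using w by simp
  next
    case False
    obtain z' where z': "z' \<in> V" "d z z' = 1" "d z' y = k"
      using gdist_split[of z y 1 k] Suc \<open>y \<in> V\<close> by auto
    then have "z' \<in> K" using sep gdist_eq_1_iff Suc False by blast
    then have "k = d z' w + d w y" using Suc(1)[of z'] z' by simp
    moreover have "d z w \<le> 1 + d z' w" using gdist_triangle[of z z' w] z' Suc w by simp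
    moreover have "d z y \<le> d z w + d w y" using gdist_triangle Suc w \<open>y \<in> V\<close> by simp
    ultimately show ?thesis using Suc(2) by simp
  qed
qed

section \<open>Blocks as maximal nonseparable vertex sets\<close>

definition maximal_nonseparable :: "'a set \<Rightarrow> bool" where
  "maximal_nonseparable S \<longleftrightarrow> S \<subseteq> V \<and> nonseparable_on E S
    \<and> (\<forall>T. S \<subseteq> T \<longrightarrow> T \<subseteq> V \<longrightarrow> nonseparable_on E T \<longrightarrow> T = S)"

lemma graph_induce_subgraph:
  assumes "S \<subseteq> V"
  shows "graph (G \<restriction> S)"
proof -
  have "induced_subgraph (G \<restriction> S) G" using assms by (rule induced_induce)
  then show ?thesis
    using digraphI_induced induced_graph_imp_symmetric[OF sym_arcs] by (intro digraph.graphI)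
qed

text \<open>The vertex set of a competing subgraph \<open>H\<close> is nonseparable in
  \<open>G\<close> too, because extra edges preserve connectedness. Maximality then leaves no new
  vertices, and the induced subgraph leaves no new arcs.\<close>

lemma is_block_induce_subgraph:
  assumes "maximal_nonseparable S"
  shows "is_block G (G \<restriction> S)"
proof -
  have S: "S \<subseteq> V" "nonseparable_on E S" using assms by (auto simp: maximal_nonseparable_def)
  have gr: "graph (G \<restriction> S)" using graph_induce_subgraph S by simp
  have sub: "subgraph (G \<restriction> S) G" using S by (intro induced_imp_subgraph induced_induce)
  have "Digraph_Component.connected (G \<restriction> S) \<and> \<not> (\<exists>v. cut_vertex (G \<restriction> S) v)"
    unfolding connected_no_cut_vertex_iff[OF gr]
    using S by (simp add: arcs_ends_induce_subgraph nonseparable_on_Int_Times)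
  moreover have "H = G \<restriction> S" if H: "subgraph (G \<restriction> S) H" "subgraph H G" "graph H"
    "Digraph_Component.connected H \<and> \<not> (\<exists>v. cut_vertex H v)" for H
  proof -
    have "nonseparable_on (arcs_ends H) (verts H)" using connected_no_cut_vertex_iff H by blast
    then have "nonseparable_on E (verts H)" using nonseparable_on_mono arcs_ends_mono H by blast
    moreover have "S \<subseteq> verts H" "verts H \<subseteq> V" using H by (auto simp: subgraph_def)
    ultimately have vH: "verts H = S" using assms by (auto simp: maximal_nonseparable_def)
    have "arcs H \<subseteq> arcs (G \<restriction> S)"
      using H vH by (auto simp: subgraph_def compatible_def wf_digraph_def)
    moreover have "arcs (G \<restriction> S) \<subseteq> arcs H" using H by (auto simp: subgraph_def)
    ultimately show ?thesis using vH H by (auto simp: subgraph_def compatible_def)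
  qed
  ultimately show ?thesis
    unfolding is_block_def max_subgraph_def using gr sub by blast
qed

lemma maximal_nonseparable_exists:
  assumes "T \<subseteq> V" "nonseparable_on E T"
  obtains S where "T \<subseteq> S" "maximal_nonseparable S"
proof -
  have "finite {S. S \<subseteq> V \<and> nonseparable_on E S}" by simp
  from finite_has_maximal2[OF this, of T] assms
  obtain S where S: "S \<in> {S. S \<subseteq> V \<and> nonseparable_on E S}" "T \<subseteq> S"
    and max: "\<forall>R\<in>{S. S \<subseteq> V \<and> nonseparable_on E S}. S \<subseteq> R \<longrightarrow> S = R" by blast
  have "maximal_nonseparable S"
    using S max by (auto simp: maximal_nonseparable_def)
  then show thesis using that S by simp
qed

lemma nonseparable_on_edge:
  assumes "(x, y) \<in> E"
  shows "nonseparable_on E {x, y}"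
proof -
  have "x \<noteq> y" using assms adj_not_same by auto
  then show ?thesis
    using connected_on_Un[OF sym_E connected_on_singleton connected_on_singleton _ _ assms]
    unfolding nonseparable_on_def
    by (auto simp: insert_Diff_if connected_on_singleton insert_commute)
qed

end

subsection \<open>Branches at a block\<close>

context connected_graph
begin

text \<open>
  \<open>branch S w\<close> consists of \<open>w\<close> and the components of \<open>G - w\<close> that miss \<open>S\<close>, that is, the part
  of \<open>G\<close> attached to the block \<open>S\<close> at \<open>w\<close>.
\<close>

definition branch :: "'a set \<Rightarrow> 'a \<Rightarrow> 'a set" where
  "branch S w = {z \<in> V. z = w \<or> (\<forall>u\<in>S - {w}. (z, u) \<notin> rtrancl_on (V - {w}) E)}"

lemma branch_subset: "branch S w \<subseteq> V"
  by (auto simp: branch_def)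

lemma branch_self: "w \<in> V \<Longrightarrow> w \<in> branch S w"
  by (simp add: branch_def)

lemma notin_branch: "S \<subseteq> V \<Longrightarrow> u \<in> S \<Longrightarrow> u \<noteq> w \<Longrightarrow> u \<notin> branch S w"
  by (auto simp: branch_def)

text \<open>If \<open>p\<close> were not \<open>w\<close>, a path from \<open>q\<close> to
  \<open>S\<close> avoiding \<open>w\<close> could be prolonged to start at
  \<open>p\<close>.\<close>

lemma branch_boundary:
  assumes "w \<in> V" "(p, q) \<in> E" "p \<in> branch S w" "q \<notin> branch S w"
  shows "p = w"
proof (rule ccontr)
  assume "p \<noteq> w"
  have "p \<in> V" "q \<in> V" using assms E_in_verts by auto
  then obtain u where u: "u \<in> S - {w}" "(q, u) \<in> rtrancl_on (V - {w}) E"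
    using assms by (auto simp: branch_def)
  then have "(p, u) \<in> rtrancl_on (V - {w}) E"
    using assms \<open>p \<noteq> w\<close> \<open>p \<in> V\<close> by (intro converse_rtrancl_on_into_rtrancl_on[OF assms(2) u(2)]) auto
  then show False using assms \<open>p \<noteq> w\<close> u by (auto simp: branch_def)
qed

lemma gdist_branch:
  assumes "w \<in> V" "z \<in> branch S w" "y \<in> V" "y \<notin> branch S w"
  shows "d z y = d z w + d w y"
  using assms branch_subset branch_boundary[OF assms(1)]
  by (intro gdist_separated[of w "branch S w" z y]) blast+

lemma gdist_branch_block:
  assumes "S \<subseteq> V" "w \<in> S" "z \<in> branch S w" "u \<in> S"
  shows "d z u = d z w + d w u"
proof (cases "u = w")
  case True
  then show ?thesis using assms by auto
next
  case False
  then show ?thesis using assms notin_branch[of S u w] by (intro gdist_branch[of w z S u]) auto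
qed

text \<open>The distance formulas of both branches at a common vertex \<open>z\<close> add up to
  \<open>d w u + d u w = 0\<close>.\<close>

lemma branch_disjoint:
  assumes "S \<subseteq> V" "w \<in> S" "u \<in> S" "w \<noteq> u" "z \<in> branch S w"
  shows "z \<notin> branch S u"
proof
  assume z: "z \<in> branch S u"
  have "d z u = d z w + d w u" "d z w = d z u + d u w"
    using gdist_branch_block[OF assms(1,2,5,3)] gdist_branch_block[OF assms(1,3) z assms(2)] .
  then have "d w u = 0" by linarith
  then show False using assms gdist_eq_0_iff[of w u] by auto
qed

text \<open>Deleting \<open>w\<close> separates \<open>z\<close> from the rest of \<open>S\<close>.
  Conversely, the branch at a vertex of \<open>S\<close> that is not a cut-vertex is
  trivial.\<close>

lemma cut_vertex_branch:
  assumes "S \<subseteq> V" "w \<in> S" "S \<noteq> {w}" "z \<in> branch S w" "z \<noteq> w"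
  shows "cut_vertex G w"
proof -
  obtain u where u: "u \<in> S" "u \<noteq> w" using assms by auto
  then have "(z, u) \<notin> rtrancl_on (V - {w}) E" using assms by (auto simp: branch_def)
  moreover have "z \<in> V" using assms branch_subset by auto
  ultimately have "\<not> connected_on E (V - {w})"
    using u assms by (auto simp: connected_on_def)
  then show ?thesis
    using u assms by (auto simp: cut_vertex_iff_connected_on[OF graph_axioms])
qed

text \<open>Otherwise the component \<open>D\<close> of \<open>z\<close> in \<open>G - S\<close>
  would be adjacent to two different vertices of \<open>S\<close>, and a path through
  \<open>D\<close> between them would be an ear enlarging \<open>S\<close>, against
  maximality.\<close>

lemma branch_cover:
  assumes S: "maximal_nonseparable S" and z: "z \<in> V"
  obtains w where "w \<in> S" "z \<in> branch S w"
proof (rule ccontr)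
  assume "\<not> thesis"
  then have no: "z \<notin> branch S w" if "w \<in> S" for w using that \<open>\<And>w. w \<in> S \<Longrightarrow> z \<in> branch S w \<Longrightarrow> thesis\<close> by blast
  have SV: "S \<subseteq> V" and nonsep: "nonseparable_on E S"
    using S by (auto simp: maximal_nonseparable_def)
  have "z \<notin> S" using no branch_self z by blast
  define D where "D = {x. (z, x) \<in> rtrancl_on (V - S) E}"
  have "z \<in> D" using z \<open>z \<notin> S\<close> by (auto simp: D_def)
  have "D \<inter> S = {}" by (auto simp: D_def dest: in_rtrancl_on_in_F)
  have exit: "\<exists>p u. (p, u) \<in> E \<and> p \<in> D \<and> u \<in> S - {w}" if w: "w \<in> S" for w
  proof -
    obtain u where u: "u \<in> S - {w}" "(z, u) \<in> rtrancl_on (V - {w}) E"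
      using no[OF w] z by (auto simp: branch_def)
    \<comment> \<open>The path avoids \<open>w\<close> and ends in \<open>S\<close>, so it leaves
      \<open>D\<close>; as \<open>D\<close> is a whole component of \<open>G - S\<close>, it can do
      so only into \<open>S\<close>.\<close>
    then obtain p q where pq: "(p, q) \<in> E" "p \<in> D \<inter> (V - {w})" "q \<in> V - {w} - D"
      using rtrancl_on_exit[of z u "V - {w}" E D] \<open>z \<in> D\<close> \<open>D \<inter> S = {}\<close> by blast
    have "q \<in> S"
    proof (rule ccontr)
      assume "q \<notin> S"
      then have "(z, q) \<in> rtrancl_on (V - S) E"
        using pq by (auto simp: D_def intro: rtrancl_on_into_rtrancl_on)
      then show False using pq by (auto simp: D_def)
    qed
    then show ?thesis using pq by auto
  qed
  obtain w0 where "w0 \<in> S" using nonsep by (auto simp: nonseparable_on_def connected_on_def)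
  then obtain p u where pu: "(p, u) \<in> E" "p \<in> D" "u \<in> S" using exit by blast
  \<comment> \<open>Applying \<open>exit\<close> again, now with \<open>u\<close> removed, supplies
    a second attachment vertex.\<close>
  then obtain q w where qw: "(q, w) \<in> E" "q \<in> D" "w \<in> S" "w \<noteq> u" using exit by blast
  have "(p, z) \<in> rtrancl_on (V - S) E"
    using rtrancl_on_sym[OF sym_E, of "V - S"] pu by (auto simp: D_def dest: symD)
  then have "(p, q) \<in> rtrancl_on (V - S) E" using qw by (auto simp: D_def intro: rtrancl_on_trans)
  then obtain xs where xs: "xs \<noteq> []" "hd xs = p" "last xs = q" "distinct xs" "set xs \<subseteq> V - S"
    "successively (\<lambda>x y. (x, y) \<in> E) xs"
    by (rule rtrancl_on_path)
  have "nonseparable_on E (S \<union> set xs)"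
    using xs pu qw symD[OF sym_E] by (intro nonseparable_on_ear[OF sym_E nonsep, of xs u w]) auto
  then have "S \<union> set xs = S" using S SV xs unfolding maximal_nonseparable_def by blast
  then show False using xs hd_in_set[of xs] by auto
qed

text \<open>These are distances in all of \<open>G\<close>: a vertex of the opposite side gives a
  path of length 2, and by \<open>E\<close> no edge of \<open>G\<close> joins two vertices of one
  side.\<close>

lemma gdist_bipartite:
  assumes X: "X \<union> Y \<subseteq> V" "X \<inter> Y = {}" "X \<noteq> {}" "Y \<noteq> {}"
    and E: "E \<inter> (X \<union> Y) \<times> (X \<union> Y) = X \<times> Y \<union> Y \<times> X"
    and p: "p \<in> X \<union> Y" and q: "q \<in> X \<union> Y"
  shows "d p q = (if p = q then 0 else if p \<in> X \<longleftrightarrow> q \<in> X then 2 else 1)"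
proof -
  have pV: "p \<in> V" "q \<in> V" using p q X by auto
  consider "p = q" | "p \<in> X \<longleftrightarrow> q \<notin> X" | "p \<in> X \<longleftrightarrow> q \<in> X" "p \<noteq> q" by blast
  then show ?thesis
  proof cases
    case 1
    then show ?thesis using pV by simp
  next
    case 2
    then have "(p, q) \<in> E" using E p q by blast
    then show ?thesis using 2 gdist_eq_1_iff pV by auto
  next
    case 3
    obtain r where r: "r \<in> X \<union> Y" "p \<in> X \<longleftrightarrow> r \<notin> X" using X by blast
    then have "(p, r) \<in> E" "(r, q) \<in> E" using E p q 3 by blast+
    then have "d p q \<le> 2"
      using gdist_triangle[of p r q] gdist_eq_1_iff[of p r] gdist_eq_1_iff[of r q] E_in_verts by auto
    moreover have "(p, q) \<notin> X \<times> Y \<union> Y \<times> X" using 3 X by auto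
    then have "(p, q) \<notin> E" using p q unfolding E[symmetric] by auto
    then have "d p q \<noteq> 1" using gdist_eq_1_iff pV by simp
    moreover have "d p q \<noteq> 0" using gdist_eq_0_iff pV 3 by simp
    ultimately show ?thesis using 3 by auto
  qed
qed

lemma gdist_le_diam:
  assumes "u \<in> V" "w \<in> V"
  shows "d u w \<le> diam G"
proof -
  have "d u w \<le> ecc G u" unfolding ecc_def using assms by (intro Max_ge) auto
  also have "\<dots> \<le> diam G" unfolding diam_def using assms by (intro Max_ge) auto
  finally show ?thesis .
qed

lemma diam_attained: obtains a b where "a \<in> V" "b \<in> V" "d a b = diam G"
proof -
  have "V \<noteq> {}" using connected_on_V by (auto simp: connected_on_def)
  then have "diam G \<in> (\<lambda>u. ecc G u) ` V" unfolding diam_def by (intro Max_in) auto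
  then obtain a where a: "a \<in> V" "diam G = ecc G a" by auto
  have "ecc G a \<in> (\<lambda>w. d a w) ` V" unfolding ecc_def using \<open>V \<noteq> {}\<close> by (intro Max_in) auto
  then show thesis using a that by auto
qed

text \<open>The branches at \<open>s\<close> and \<open>t\<close> contain the ends of a diametral
  path and are the only nontrivial ones, so distances to \<open>s\<close> and \<open>t\<close>
  govern the matrix. The condition \<open>d a s = m\<close> settles which branch goes into
  \<open>L\<close>.\<close>

lemma inertia_ecc_matrix_central_block:
  assumes S: "maximal_nonseparable S" and SXY: "S = X \<union> Y" and XY: "X \<inter> Y = {}" "X \<noteq> {}" "Y \<noteq> {}"
    and E: "E \<inter> S \<times> S = X \<times> Y \<union> Y \<times> X"
    and cut: "card {v \<in> S. cut_vertex G v} \<le> 2"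
    and diam: "\<And>u v. u \<in> V \<Longrightarrow> v \<in> V \<Longrightarrow> d u v \<le> 2 * m + 1" and m: "m \<ge> 2"
    and ab: "a \<in> branch S s" "b \<in> branch S t" "d a b = 2 * m + 1"
    and st: "s \<in> S" "t \<in> S" "s \<noteq> t" and as: "d a s = m"
    and bij: "bij_betw v {..<n} V"
  shows "inertia (ecc_matrix G n v) = (2, 2, n - 4)
    \<and> eigen_mult (ecc_matrix G n v) \<theta> = eigen_mult (ecc_matrix G n v) (- \<theta>)"
proof -
  have SV: "S \<subseteq> V" using S by (auto simp: maximal_nonseparable_def)
  have stV: "s \<in> V" "t \<in> V" and abV: "a \<in> V" "b \<in> V" using st SV ab branch_subset by auto
  define \<delta> where "\<delta> = d s t"
  have dist: "d p q = (if p = q then 0 else if p \<in> X \<longleftrightarrow> q \<in> X then 2 else 1)"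
    if "p \<in> S" "q \<in> S" for p q
    using that gdist_bipartite[of X Y p q] SV XY E unfolding SXY by blast
  have \<delta>: "\<delta> = 1 \<or> \<delta> = 2" using dist[of s t] st by (auto simp: \<delta>_def)
  have \<delta>': "d t s = \<delta>" using gdist_sym stV by (simp add: \<delta>_def)
  have to_s: "d z s = d z t + \<delta>" if "z \<in> branch S t" for z
    using gdist_branch_block[OF SV st(2) that st(1)] \<delta>' by simp
  have to_t: "d z t = d z s + \<delta>" if "z \<in> branch S s" for z
    using gdist_branch_block[OF SV st(1) that st(2)] by (simp add: \<delta>_def)
  have "d a b = d a s + d b s"
    using gdist_branch[OF stV(1) ab(1) abV(2)] branch_disjoint[OF SV st(2) st(1) _ ab(2)] st(3)
      gdist_sym[OF stV(1) abV(2)] by auto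
  then have bs: "d b s = m + 1" using ab as by simp
  have bt: "d b t + \<delta> = m + 1" using to_s[OF ab(2)] bs by simp
  \<comment> \<open>As \<open>m \<ge> 2\<close>, both branches are nontrivial, so \<open>s\<close>
    and \<open>t\<close> are cut-vertices, and \<open>cut\<close> leaves no others in
    \<open>S\<close>.\<close>
  have "a \<noteq> s" "b \<noteq> t" using as bt m \<delta> stV by auto
  then have "cut_vertex G s" "cut_vertex G t"
    using cut_vertex_branch[OF SV st(1) _ ab(1)] cut_vertex_branch[OF SV st(2) _ ab(2)] st by auto
  then have "{s, t} \<subseteq> {v \<in> S. cut_vertex G v}" using st by auto
  moreover have "finite {v \<in> S. cut_vertex G v}" using SV finite_verts finite_subset by fastforce
  ultimately have cuts: "{v \<in> S. cut_vertex G v} = {s, t}"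
    using cut st by (intro card_seteq[symmetric]) auto
  have cover: "z \<in> branch S s \<or> z \<in> branch S t \<or> z \<in> S - {s, t}" if z: "z \<in> V" for z
  proof -
    obtain w where w: "w \<in> S" "z \<in> branch S w" using branch_cover[OF S z] .
    show ?thesis
    proof (cases "w = s \<or> w = t")
      case False
      then have "\<not> cut_vertex G w" using cuts w by auto
      then have "z = w" using cut_vertex_branch[OF SV w(1) _ w(2)] st by auto
      then show ?thesis using w False by auto
    qed (use w in auto)
  qed
  \<comment> \<open>For \<delta> = 2 the vertices \<open>s\<close> and \<open>t\<close> lie on one
    side of the bipartition and are equally far from \<open>z\<close>; for \<delta> = 1 they lie on
    different sides.\<close>
  have mid: "(d z s = 1 \<or> d z s = 2) \<and> (d z t = 1 \<or> d z t = 2) \<and> (d z s = d z t \<longleftrightarrow> \<delta> = 2)"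
    if "z \<in> S - {s, t}" for z
    using that dist[of z s] dist[of z t] dist[of s t] st unfolding \<delta>_def by auto
  text \<open>
    If \<open>\<delta> = 1\<close>, the edge \<open>st\<close> is the centre and \<open>h\<close> is the distance to it. If \<open>\<delta> = 2\<close>, the central
    edges join \<open>s\<close> to its common neighbours with \<open>t\<close>; these lie outside \<open>L\<close> and have height \<open>0\<close>.
  \<close>
  define L where "L = {z. d z t = d z s + \<delta>}"
  define h where "h z = (if z \<in> L then d z s else d z s - 1)" for z
  have in_s: "z \<in> L" "h z = d z s" "d z s \<le> m" if "z \<in> branch S s" for z
  proof -
    show "z \<in> L" "h z = d z s" using to_t[OF that] by (auto simp: L_def h_def)
    \<comment> \<open>The diameter bound for \<open>z\<close> and \<open>b\<close>, with
      \<open>d b s = m + 1\<close>, leaves at most \<open>m\<close> for \<open>d z s\<close>. The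
      other branch is bounded in the same way by means of \<open>a\<close>.\<close>
    have "d z b = d z s + d s b"
      using gdist_branch[OF stV(1) that abV(2)] branch_disjoint[OF SV st(2) st(1) _ ab(2)] st(3) by auto
    then show "d z s \<le> m"
      using diam[of z b] bs gdist_sym[OF stV(1) abV(2)] that branch_subset abV by auto
  qed
  have in_t: "z \<notin> L" "h z + 1 = d z t + \<delta>" "d z t + \<delta> \<le> m + 1" if "z \<in> branch S t" for z
  proof -
    show "z \<notin> L" "h z + 1 = d z t + \<delta>" using to_s[OF that] \<delta> by (auto simp: L_def h_def)
    have "d z a = d z t + d t a"
      using gdist_branch[OF stV(2) that abV(1)] branch_disjoint[OF SV st(1) st(2) _ ab(1)] st(3) by auto
    then show "d z t + \<delta> \<le> m + 1"
      using diam[of z a] as to_t[OF ab(1)] gdist_sym[OF stV(2) abV(1)] that branch_subset abV by auto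
  qed
  \<comment> \<open>Such a vertex lies in \<open>L\<close> only as a neighbour of \<open>s\<close>
    with \<delta> = 1. Off \<open>L\<close> its distance to \<open>s\<close> is positive, so the
    subtraction in \<open>h\<close> is not truncated.\<close>
  have h_mid: "h z \<le> 1 \<and> (z \<in> L \<longrightarrow> \<delta> = 1 \<and> d z t = 2 \<and> h z = 1 \<and> d z s = 1)
      \<and> (z \<notin> L \<longrightarrow> d z s = h z + 1 \<and> d z t + 1 = h z + \<delta>)" if z: "z \<in> S - {s, t}" for z
  proof -
    have "d z s = 1 \<and> d z t = 1 \<and> \<delta> = 2 \<or> d z s = 2 \<and> d z t = 2 \<and> \<delta> = 2
        \<or> d z s = 1 \<and> d z t = 2 \<and> \<delta> = 1 \<or> d z s = 2 \<and> d z t = 1 \<and> \<delta> = 1"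
      using mid[OF z] \<delta> by (elim disjE conjE) simp_all
    then show ?thesis by (elim disjE conjE) (simp_all add: L_def h_def)
  qed
  have sep_s: "d y z = d y s + d z s" if "y \<in> branch S s" "z \<in> V" "z \<notin> branch S s" for y z
    using gdist_branch[OF stV(1) that] gdist_sym[OF stV(1) that(2)] by simp
  have sep_t: "d y z = d y t + d z t" if "y \<in> branch S t" "z \<in> V" "z \<notin> branch S t" for y z
    using gdist_branch[OF stV(2) that] gdist_sym[OF stV(2) that(2)] by simp
  \<comment> \<open>Out of a branch, distances add through \<open>s\<close> or \<open>t\<close>. The
    last alternative is for two vertices of \<open>S - {s, t}\<close>: their heights are at most 1,
    hence below \<open>m\<close>, so \<open>cross_eq\<close> does not concern them.\<close>
  have main: "(y \<in> L \<longleftrightarrow> z \<in> L) \<and> d y z \<le> max 2 (h y + h z)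
      \<or> (y \<in> L \<longleftrightarrow> z \<notin> L) \<and> (d y z = h y + h z + 1 \<or> d y z \<le> 2 \<and> h y \<le> 1 \<and> h z \<le> 1)"
    if y: "y \<in> V" and z: "z \<in> V" and "y \<in> branch S s \<or> y \<in> branch S t \<and> z \<notin> branch S s
       \<or> y \<in> S - {s, t} \<and> z \<in> S - {s, t}" for y z
    using that(3)
  proof (elim disjE conjE)
    assume ys: "y \<in> branch S s"
    show ?thesis
    proof (cases "z \<in> branch S s")
      case True
      then show ?thesis
        using in_s[OF ys] in_s[OF True] gdist_triangle[OF y stV(1) z] gdist_sym[OF stV(1) z] by auto
    next
      case False
      then have "z \<in> branch S t \<or> z \<in> S - {s, t}" using cover z by blast
      then show ?thesis
        using sep_s[OF ys z False] in_s[OF ys] in_t[of z] to_s[of z] h_mid[of z] by auto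
    qed
  next
    assume yt: "y \<in> branch S t" and zs: "z \<notin> branch S s"
    show ?thesis
    proof (cases "z \<in> branch S t")
      case True
      then show ?thesis
        using in_t[OF yt] in_t[OF True] gdist_triangle[OF y stV(2) z] gdist_sym[OF stV(2) z] \<delta> by auto
    next
      case False
      then have "z \<in> S - {s, t}" using cover z zs by blast
      then show ?thesis
        using sep_t[OF yt z False] in_t[OF yt] h_mid[of z] by (cases "z \<in> L") auto
    qed
  next
    assume mids: "y \<in> S - {s, t}" "z \<in> S - {s, t}"
    then have "d y z \<le> 2" using dist[of y z] by auto
    then show ?thesis using h_mid mids by auto
  qed
  have all: "(y \<in> L \<longleftrightarrow> z \<in> L) \<and> d y z \<le> max 2 (h y + h z)
      \<or> (y \<in> L \<longleftrightarrow> z \<notin> L) \<and> (d y z = h y + h z + 1 \<or> d y z \<le> 2 \<and> h y \<le> 1 \<and> h z \<le> 1)"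
    if y: "y \<in> V" and z: "z \<in> V" for y z
    using main[OF y z] main[OF z y] gdist_sym[OF y z] cover[OF y] cover[OF z]
    by (auto simp: add.commute)
  \<comment> \<open>The vertex \<open>w\<close> of height \<open>0\<close> outside \<open>L\<close>
    is \<open>t\<close> if \<delta> = 1 and a common neighbour of \<open>s\<close> and
    \<open>t\<close> if \<delta> = 2.\<close>
  have "d s t = 1 + (\<delta> - 1)" using \<delta> unfolding \<delta>_def by linarith
  then obtain w where w: "w \<in> V" "d s w = 1" "d w t = \<delta> - 1" by (rule gdist_split[OF stV])
  have h_le: "h z \<le> m" if "z \<in> V" for z
    using cover[OF that] in_s[of z] in_t[of z] h_mid[of z] m by auto
  have same: "d y z \<le> max 2 (h y + h z)" if "y \<in> V" "z \<in> V" "y \<in> L \<longleftrightarrow> z \<in> L" for y z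
    using all[OF that(1,2)] that(3) by blast
  have cross: "d y z \<le> max 2 (h y + h z + 1)" if "y \<in> V \<inter> L" "z \<in> V - L" for y z
    using all[of y z] that by auto
  have cross_eq: "d y z = h y + h z + 1" if "y \<in> V \<inter> L" "z \<in> V - L" "h y = m \<or> h z = m" for y z
    using all[of y z] that m by auto
  have "d w s = 1" using w gdist_sym stV by simp
  then have "s \<in> V \<inter> L" "h s = 0" "a \<in> V \<inter> L" "h a = m" "w \<in> V - L" "h w = 0" "b \<in> V - L" "h b = m"
    using in_s[OF branch_self[OF stV(1)]] in_s[OF ab(1)] in_t[OF ab(2)] stV abV as bt w
    by (auto simp: L_def h_def)
  from inertia_ecc_matrix_of_layers[OF bij m h_le gdist_sym same cross cross_eq this]
  show ?thesis by blast
qed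

end

theorem theorem4p2:
  fixes G :: "('a, 'b) pre_digraph" and v :: "nat \<Rightarrow> 'a" and n m :: nat
  assumes "in_class_B G"
    and "bij_betw v {..<n} (verts G)"
    and "diam G = 2 * m + 1"
    and "m \<ge> 2"
  shows "inertia (ecc_matrix G n v) = (2, 2, n - 4)
    \<and> (\<forall>\<mu>::real. eigen_mult (ecc_matrix G n v) \<mu> = eigen_mult (ecc_matrix G n v) (- \<mu>))"
proof -
  have bb: "bi_block_graph G" using assms(1) by (simp add: in_class_B_def)
  interpret connected_graph G
    using bb by (simp add: bi_block_graph_def connected_graph_def connected_graph_axioms_def)
  have diam: "d u w \<le> 2 * m + 1" if "u \<in> V" "w \<in> V" for u w
    using gdist_le_diam[OF that] assms(3) by simp
  obtain a b where ab: "a \<in> V" "b \<in> V" "d a b = 2 * m + 1"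
    using diam_attained assms(3) by metis
  then have "d a b = m + (m + 1)" by simp
  then obtain x where x: "x \<in> V" "d a x = m" "d x b = 1 + m"
    using gdist_split[OF ab(1,2)] by (metis add.commute)
  then obtain y where y: "y \<in> V" "d x y = 1" "d y b = m" using gdist_split[OF x(1) ab(2)] by metis
  have xy: "(x, y) \<in> E" using gdist_eq_1_iff x(1) y by simp
  have ay: "d a y = m + 1"
    using gdist_triangle[of a x y] gdist_triangle[of a y b] ab x y by simp
  have by_m: "d b y = m" and bx: "d b x = m + 1" using gdist_sym ab x y by auto

  obtain S where "{x, y} \<subseteq> S" and S: "maximal_nonseparable S"
    using maximal_nonseparable_exists[OF _ nonseparable_on_edge[OF xy]] x(1) y(1) by auto
  then have xyS: "x \<in> S" "y \<in> S" and SV: "S \<subseteq> V" by (auto simp: maximal_nonseparable_def)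
  have block: "is_block G (G \<restriction> S)" using is_block_induce_subgraph[OF S] .
  then obtain p q where "p \<ge> 1" "q \<ge> 1" "complete_bipartite_digraph p q (G \<restriction> S)"
    using bb unfolding bi_block_graph_def by blast
  then obtain X Y where "S = X \<union> Y" "X \<inter> Y = {}" "card X \<ge> 1" "card Y \<ge> 1"
    and E: "E \<inter> S \<times> S = X \<times> Y \<union> Y \<times> X"
    unfolding complete_bipartite_digraph_def by (metis arcs_ends_induce_subgraph induce_subgraph_verts)
  then have XY: "S = X \<union> Y" "X \<inter> Y = {}" "X \<noteq> {}" "Y \<noteq> {}" by auto
  have cut: "card {v \<in> S. cut_vertex G v} \<le> 2"
    using assms(1) block unfolding in_class_B_def by fastforce
  obtain s where s: "s \<in> S" "a \<in> branch S s" using branch_cover[OF S ab(1)] .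
  obtain t where t: "t \<in> S" "b \<in> branch S t" using branch_cover[OF S ab(2)] .
  have a_dist: "d a x = d a s + d s x" "d a y = d a s + d s y"
    using gdist_branch_block[OF SV s] xyS by auto
  have b_dist: "d b x = d b t + d t x" "d b y = d b t + d t y"
    using gdist_branch_block[OF SV t] xyS by auto
  \<comment> \<open>From \<open>x\<close> to \<open>y\<close> the distance from \<open>a\<close>
    grows by 1 and that from \<open>b\<close> drops by 1. With a common attachment vertex both
    changes would equal the change of the distance from that vertex.\<close>
  have "s \<noteq> t"
  proof
    assume "s = t"
    then show False using a_dist[unfolded \<open>s = t\<close>] b_dist x(2) ay by_m bx by linarith
  qed
  have "b \<notin> branch S s" using branch_disjoint[OF SV t(1) s(1) _ t(2)] \<open>s \<noteq> t\<close> by auto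
  then have "d a b = d a s + d s b" using gdist_branch[OF _ s(2) ab(2)] s(1) SV by auto
  moreover have "d s b = d b t + d t s"
    using gdist_branch_block[OF SV t s(1)] gdist_sym[of s b] s(1) SV ab(2) by auto
  moreover have "d t s \<le> 2"
    using gdist_bipartite[of X Y t s] XY E SV s(1) t(1) by simp
  moreover have "d a s \<le> m" "d b t \<le> m" using a_dist(1) b_dist(2) x(2) by_m by auto
  \<comment> \<open>The sum \<open>d a s + d b t + d t s\<close> is \<open>2 * m + 1\<close> and its
    last term is at most 2, so the other two cannot both be below \<open>m\<close>.\<close>
  ultimately have "d a s = m \<or> d b t = m" using ab(3) by linarith
  \<comment> \<open>The two cases are exchanged by reversing the path.\<close>
  then show ?thesis
  proof
    assume "d a s = m"
    then show ?thesis
      using inertia_ecc_matrix_central_block[OF S XY E cut diam assms(4) s(2) t(2)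
          ab(3) s(1) t(1) \<open>s \<noteq> t\<close> _ assms(2)]
      by blast
  next
    assume "d b t = m"
    moreover have "d b a = 2 * m + 1" using ab gdist_sym by simp
    ultimately show ?thesis
      using inertia_ecc_matrix_central_block[OF S XY E cut diam assms(4) t(2) s(2)
          _ t(1) s(1) \<open>s \<noteq> t\<close>[symmetric] _ assms(2)]
      by blast
  qed
qed

end
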